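(* Let $A$ be a finite alphabet. The antipode $S^*$ of $\mathrm{QSym}_A$ is given in the fundamental basis, for every sentence $I$ over $A$, by $$S^*(F_I)=(-1)^{|I|}\,r(F_{I^c}).$$
   Context: $\Bbbk$ is a field of characteristic zero. A sentence $I=(w_1,\dots,w_m)$ over $A$ is a finite sequence of non-empty words in letters of $A$; $1$ is the empty sentence. $|I|$ is the total number of letters; the maximal word of $I$ is $w(I)=w_1\cdots w_m$. Write $J\preccurlyeq I$ ($J$ refines $I$) if the words of $I$ can be obtained by concatenating adjacent words of $J$. The reversal is $I^r=(w_m,\dots,w_1)$. The complement $I^c$ is the sentence with the same maximal word as $I$ in which two consecutive letters of $w(I)$ are separated (belong to different words) if and only if they are not separated in $I$; e.g. $(aba,ca,bac)^c=(a,b,ac,ab,a,c)$. $\mathrm{QSym}_A$ is the Hopf algebra over $\Bbbk$ with linear basis $(M_I)$ indexed by sentences over $A$; its coproduct is $\delta(M_I)=\sum_{J\cdot K=I}M_J\otimes M_K$, where $\cdot$ is concatenation of sentences. Its product is $M_IM_J=\sum_KM_K$ with $K$ running over the summands (with multiplicity) of the quasi-shuffle $I*J$, defined recursively by $I*1=1*I=I$ and $((u)\cdot I)*((v)\cdot J)=(u)\cdot(I*((v)\cdot J))+(v)\cdot(((u)\cdot I)*J)+(uv)\cdot(I*J)$ for non-empty words $u,v$. $S^*$ is its antipode. The fundamental functions are $F_I=\sum_{J\preccurlyeq I}M_J$, and $r$ is the linear map on $\mathrm{QSym}_A$ with $r(M_I)=M_{I^r}$. *)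

theory Defs
  imports Complex_Main "HOL-Library.Poly_Mapping" "HOL-Library.Multiset"
begin

section \<open>Sentences\<close>

text \<open>Words are non-empty by definition, so sentences are just lists of words. Concatenation of
  sentences is \<open>@\<close>, the empty sentence is \<open>[]\<close>, and reversal of a sentence is \<^const>\<open>rev\<close>.\<close>

typedef 'a word = "{w :: 'a list. w \<noteq> []}"
  morphisms letters Word
  by blast

type_synonym 'a sentence = "'a word list"

definition word_append :: "'a word \<Rightarrow> 'a word \<Rightarrow> 'a word" where
  "word_append u v = Word (letters u @ letters v)"

definition maximal_word :: "'a sentence \<Rightarrow> 'a list" where
  "maximal_word I = concat (map letters I)"

definition sentence_size :: "'a sentence \<Rightarrow> nat" where
  "sentence_size I = length (maximal_word I)"

text \<open>\<open>refines J I\<close> reads \<open>J \<preceq> I\<close>: here \<open>G\<close> groups adjacent words of \<open>J\<close>, one group for each word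
  of \<open>I\<close>. Groups are automatically non-empty because the words of \<open>I\<close> are.\<close>

definition refines :: "'a sentence \<Rightarrow> 'a sentence \<Rightarrow> bool" where
  "refines J I \<longleftrightarrow> (\<exists>G. concat G = J \<and> map maximal_word G = map letters I)"

text \<open>The \<open>i\<close>-th and \<open>(i+1)\<close>-st letters (counting from 1) of the maximal word of \<open>I\<close> belong to
  different words of \<open>I\<close>.\<close>

definition separated :: "'a sentence \<Rightarrow> nat \<Rightarrow> bool" where
  "separated I i \<longleftrightarrow> (\<exists>J K. I = J @ K \<and> J \<noteq> [] \<and> K \<noteq> [] \<and> sentence_size J = i)"

definition is_complement :: "'a sentence \<Rightarrow> 'a sentence \<Rightarrow> bool" where
  "is_complement I J \<longleftrightarrow> maximal_word J = maximal_word I \<and>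
     (\<forall>i. 0 < i \<and> i < sentence_size I \<longrightarrow> (separated J i \<longleftrightarrow> \<not> separated I i))"

text \<open>Well defined by \<open>ex1_complement\<close> below.\<close>

definition complement :: "'a sentence \<Rightarrow> 'a sentence" where
  "complement I = (THE J. is_complement I J)"

fun quasi_shuffle :: "'a sentence \<Rightarrow> 'a sentence \<Rightarrow> 'a sentence multiset" where
  "quasi_shuffle I [] = {#I#}"
| "quasi_shuffle [] (v # J) = {#v # J#}"
| "quasi_shuffle (u # I) (v # J) =
     image_mset ((#) u) (quasi_shuffle I (v # J)) +
     image_mset ((#) v) (quasi_shuffle (u # I) J) +
     image_mset ((#) (word_append u v)) (quasi_shuffle I J)"


section \<open>The Hopf algebra QSym\<close>

text \<open>The free vector space on a basis \<open>'b\<close> is \<open>'b \<Rightarrow>\<^sub>0 'k\<close>; the tensor square of the free vector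
  space on \<open>'b\<close> is the free vector space on \<open>'b \<times> 'b\<close>.\<close>

type_synonym ('a, 'k) qsym = "'a sentence \<Rightarrow>\<^sub>0 'k"
type_synonym ('a, 'k) qsym2 = "('a sentence \<times> 'a sentence) \<Rightarrow>\<^sub>0 'k"

definition scale :: "'k \<Rightarrow> ('b \<Rightarrow>\<^sub>0 'k) \<Rightarrow> ('b \<Rightarrow>\<^sub>0 'k::field)" where
  "scale c p = Poly_Mapping.map (\<lambda>x. c * x) p"

definition lin_extend :: "('b \<Rightarrow> ('c \<Rightarrow>\<^sub>0 'k)) \<Rightarrow> ('b \<Rightarrow>\<^sub>0 'k) \<Rightarrow> ('c \<Rightarrow>\<^sub>0 'k::field)" where
  "lin_extend f p = (\<Sum>b \<in> Poly_Mapping.keys p. scale (Poly_Mapping.lookup p b) (f b))"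

definition tensor :: "('a, 'k) qsym \<Rightarrow> ('a, 'k) qsym \<Rightarrow> ('a, 'k::field) qsym2" where
  "tensor p q = (\<Sum>I \<in> Poly_Mapping.keys p. \<Sum>J \<in> Poly_Mapping.keys q.
     Poly_Mapping.single (I, J) (Poly_Mapping.lookup p I * Poly_Mapping.lookup q J))"

definition M :: "'a sentence \<Rightarrow> ('a, 'k::field) qsym" where
  "M I = Poly_Mapping.single I 1"

definition tensor_map ::
  "(('a, 'k) qsym \<Rightarrow> ('a, 'k) qsym) \<Rightarrow> (('a, 'k) qsym \<Rightarrow> ('a, 'k) qsym) \<Rightarrow>
   ('a, 'k) qsym2 \<Rightarrow> ('a, 'k::field) qsym2" where
  "tensor_map f g = lin_extend (\<lambda>(I, J). tensor (f (M I)) (g (M J)))"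

text \<open>The product as a linear map on the tensor square; the unit is \<open>M []\<close>.\<close>

definition qmult :: "('a, 'k) qsym2 \<Rightarrow> ('a, 'k::field) qsym" where
  "qmult = lin_extend (\<lambda>(I, J). \<Sum>K \<in># quasi_shuffle I J. M K)"

definition qunit :: "'k \<Rightarrow> ('a, 'k::field) qsym" where
  "qunit c = scale c (M [])"

definition qcomult :: "('a, 'k) qsym \<Rightarrow> ('a, 'k::field) qsym2" where
  "qcomult = lin_extend (\<lambda>I. \<Sum>(J, K) \<in> {(J, K). J @ K = I}. tensor (M J) (M K))"

text \<open>The only counit of \<^const>\<open>qcomult\<close>: it sends \<open>M []\<close> to 1 and all other \<open>M I\<close> to 0.\<close>

definition qcounit :: "('a, 'k) qsym \<Rightarrow> 'k::field" where
  "qcounit p = Poly_Mapping.lookup p []"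

definition is_antipode :: "(('a, 'k) qsym \<Rightarrow> ('a, 'k::field) qsym) \<Rightarrow> bool" where
  "is_antipode S \<longleftrightarrow> Vector_Spaces.linear scale scale S \<and>
     (\<forall>p. qmult (tensor_map S id (qcomult p)) = qunit (qcounit p)) \<and>
     (\<forall>p. qmult (tensor_map id S (qcomult p)) = qunit (qcounit p))"

definition antipode :: "('a, 'k) qsym \<Rightarrow> ('a, 'k::field) qsym" where
  "antipode = (THE S. is_antipode S)"

definition F :: "'a sentence \<Rightarrow> ('a, 'k::field) qsym" where
  "F I = (\<Sum>J \<in> {J. refines J I}. M J)"

definition qrev :: "('a, 'k) qsym \<Rightarrow> ('a, 'k::field) qsym" where
  "qrev = lin_extend (\<lambda>I. M (rev I))"


section \<open>Well-definedness of the index sets and of the complement\<close>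

lemma letters_nonempty [simp]: "letters w \<noteq> []"
  using letters[of w] by simp

lemma maximal_word_simps [simp]:
  "maximal_word [] = []"
  "maximal_word (w # I) = letters w @ maximal_word I"
  "maximal_word (I @ J) = maximal_word I @ maximal_word J"
  by (simp_all add: maximal_word_def)

lemma maximal_word_eq_Nil [simp]: "maximal_word I = [] \<longleftrightarrow> I = []"
  by (cases I) auto

lemma maximal_word_concat: "maximal_word (concat G) = concat (map maximal_word G)"
  by (induction G) auto

lemma refines_maximal_word: "refines J I \<Longrightarrow> maximal_word J = maximal_word I"
  unfolding refines_def by (metis maximal_word_concat maximal_word_def)

lemma finite_maximal_word: "finite {J. maximal_word J = w}"
proof (induction w rule: length_induct)
  case (1 w)
  let ?X = "\<lambda>n. {J. maximal_word J = drop n w}"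
  have "{J. maximal_word J = w} \<subseteq> {[]} \<union>
    (\<Union>n \<in> {1..length w}. (\<lambda>J. Word (take n w) # J) ` ?X n)"
  proof
    fix J assume "J \<in> {J. maximal_word J = w}"
    then have J: "maximal_word J = w" by simp
    show "J \<in> {[]} \<union> (\<Union>n \<in> {1..length w}. (\<lambda>J. Word (take n w) # J) ` ?X n)"
    proof (cases J)
      case (Cons u K)
      then have w: "w = letters u @ maximal_word K" using J by simp
      have "length (letters u) \<in> {1..length w}" using w by (simp add: Suc_leI)
      moreover have "J = Word (take (length (letters u)) w) # K"
        using w Cons by (simp add: letters_inverse)
      moreover have "K \<in> ?X (length (letters u))" using w by simp
      ultimately show ?thesis by blast
    qed simp
  qed
  moreover have "finite (?X n)" if "n \<in> {1..length w}" for n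
  proof -
    have "length (drop n w) < length w" using that by auto
    then show ?thesis using 1 by blast
  qed
  ultimately show ?case by (elim finite_subset) blast
qed

lemma finite_refines: "finite {J. refines J I}"
  by (rule finite_subset[OF _ finite_maximal_word[of "maximal_word I"]])
    (auto dest: refines_maximal_word)

lemma finite_deconcatenations: "finite {(J, K). J @ K = (I :: 'b list)}"
proof -
  have "{(J, K). J @ K = I} \<subseteq> (\<lambda>n. (take n I, drop n I)) ` {..length I}"
  proof
    fix x assume "x \<in> {(J, K). J @ K = I}"
    then obtain J K where "x = (J, K)" "J @ K = I" by auto
    then have "x = (take (length J) I, drop (length J) I)" "length J \<in> {..length I}" by auto
    then show "x \<in> (\<lambda>n. (take n I, drop n I)) ` {..length I}" by blast
  qed
  then show ?thesis by (rule finite_subset) simp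
qed

lemma separated_Nil [simp]: "\<not> separated [] i"
  by (simp add: separated_def)

lemma separated_Cons:
  "separated (w # I) i \<longleftrightarrow> I \<noteq> [] \<and> (i = length (letters w) \<or>
     (length (letters w) < i \<and> separated I (i - length (letters w))))"
proof
  assume "separated (w # I) i"
  then obtain J K where *: "w # I = J @ K" "J \<noteq> []" "K \<noteq> []" "sentence_size J = i"
    by (auto simp: separated_def)
  then obtain J' where J': "J = w # J'" "I = J' @ K" by (cases J) auto
  show "I \<noteq> [] \<and> (i = length (letters w) \<or>
     (length (letters w) < i \<and> separated I (i - length (letters w))))"
  proof (cases "J' = []")
    case True
    then show ?thesis using * J' by (auto simp: sentence_size_def)
  next
    case False
    then have "separated I (sentence_size J')" using * J' by (auto simp: separated_def)
    moreover have "i = length (letters w) + sentence_size J'" "sentence_size J' > 0"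
      using * J' False by (auto simp: sentence_size_def)
    ultimately show ?thesis using * J' by auto
  qed
next
  assume R: "I \<noteq> [] \<and> (i = length (letters w) \<or>
     (length (letters w) < i \<and> separated I (i - length (letters w))))"
  then consider "i = length (letters w)"
    | J K where "length (letters w) < i" "I = J @ K" "J \<noteq> []" "K \<noteq> []"
        "sentence_size J = i - length (letters w)"
    by (auto simp: separated_def)
  then show "separated (w # I) i"
  proof cases
    case 1
    then have "w # I = [w] @ I \<and> [w] \<noteq> [] \<and> I \<noteq> [] \<and> sentence_size [w] = i"
      using R by (simp add: sentence_size_def)
    then show ?thesis unfolding separated_def by blast
  next
    case 2
    then have "w # I = (w # J) @ K \<and> w # J \<noteq> [] \<and> K \<noteq> [] \<and> sentence_size (w # J) = i"
      by (simp add: sentence_size_def)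
    then show ?thesis unfolding separated_def by blast
  qed
qed

text \<open>A sentence is determined by its maximal word together with an arbitrary choice of separated
  positions.\<close>

lemma ex_sentence:
  "\<exists>J. maximal_word J = w \<and> (\<forall>i. 0 < i \<and> i < length w \<longrightarrow> (separated J i \<longleftrightarrow> P i))"
proof (induction w arbitrary: P)
  case Nil
  show ?case by (rule exI[of _ "[]"]) simp
next
  case (Cons a w)
  obtain J where J: "maximal_word J = w"
    "\<And>i. 0 < i \<Longrightarrow> i < length w \<Longrightarrow> separated J i \<longleftrightarrow> P (Suc i)"
    using Cons.IH[of "\<lambda>i. P (Suc i)"] by blast
  have La: "letters (Word [a]) = [a]" by (simp add: Word_inverse)
  show ?case
  proof (cases "J = [] \<or> P 1")
    case True
    let ?J = "Word [a] # J"
    have "separated ?J i \<longleftrightarrow> P i" if "0 < i" "i < length (a # w)" for i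
    proof -
      have "J \<noteq> []" using that J(1) by auto
      then show ?thesis using that True J(2)[of "i - 1"]
        by (cases "i = 1") (auto simp: separated_Cons La)
    qed
    moreover have "maximal_word ?J = a # w" using J(1) La by simp
    ultimately show ?thesis by blast
  next
    case False
    then obtain u K where JK: "J = u # K" by (cases J) auto
    let ?J = "Word (a # letters u) # K"
    have Lu: "letters (Word (a # letters u)) = a # letters u" by (simp add: Word_inverse)
    have "separated ?J i \<longleftrightarrow> P i" if "0 < i" "i < length (a # w)" for i
    proof (cases "i = 1")
      case True
      then show ?thesis using False by (simp add: separated_Cons Lu)
    next
      case False
      then have "separated J (i - 1) \<longleftrightarrow> P i" using that J(2)[of "i - 1"] by simp
      moreover have "separated J (i - 1) \<longleftrightarrow> separated ?J i"
        using that False unfolding JK separated_Cons Lu by auto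
      ultimately show ?thesis by simp
    qed
    moreover have "maximal_word ?J = a # w" using J(1) JK Lu by simp
    ultimately show ?thesis by blast
  qed
qed

lemma sentence_eqI:
  assumes "maximal_word J = maximal_word K"
    and "\<And>i. 0 < i \<Longrightarrow> i < sentence_size J \<Longrightarrow> separated J i \<longleftrightarrow> separated K i"
  shows "J = K"
  using assms
proof (induction J arbitrary: K)
  case Nil
  then show ?case by (metis maximal_word_eq_Nil maximal_word_simps(1))
next
  case (Cons u J)
  then obtain v K' where K: "K = v # K'"
    by (metis maximal_word_eq_Nil list.exhaust list.discI)
  have mw: "letters u @ maximal_word J = letters v @ maximal_word K'"
    using Cons.prems(1) K by simp
  then have len: "length (letters u) + length (maximal_word J)
      = length (letters v) + length (maximal_word K')"
    by (metis length_append)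
  have sep: "separated (u # J) i \<longleftrightarrow> separated (v # K') i"
    if "0 < i" "i < length (letters u) + length (maximal_word J)" for i
    using Cons.prems(2)[of i] that K by (simp add: sentence_size_def)
  have "\<not> length (letters u) < length (letters v)"
  proof
    assume lt: "length (letters u) < length (letters v)"
    then have "J \<noteq> []" using len by auto
    then have "separated (v # K') (length (letters u))"
      using sep[of "length (letters u)"] by (simp add: separated_Cons)
    then show False using lt by (simp add: separated_Cons)
  qed
  moreover have "\<not> length (letters v) < length (letters u)"
  proof
    assume lt: "length (letters v) < length (letters u)"
    then have "K' \<noteq> []" using len by auto
    then have "separated (u # J) (length (letters v))"
      using sep[of "length (letters v)"] len by (simp add: separated_Cons)
    then show False using lt by (simp add: separated_Cons)
  qed
  ultimately have l: "length (letters u) = length (letters v)" by simp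
  then have "letters u = letters v" and mw': "maximal_word J = maximal_word K'"
    using mw by auto
  then have uv: "u = v" by (simp add: letters_inject)
  have "separated J i \<longleftrightarrow> separated K' i" if i: "0 < i" "i < sentence_size J" for i
  proof -
    have "J \<noteq> []" "K' \<noteq> []" using i mw' by (auto simp: sentence_size_def)
    then show ?thesis using sep[of "length (letters u) + i"] i l
      by (simp add: separated_Cons sentence_size_def)
  qed
  then have "J = K'" by (rule Cons.IH[OF mw'])
  then show ?case using uv K by simp
qed

lemma ex1_complement: "\<exists>!J. is_complement I J"
proof (rule ex_ex1I)
  show "\<exists>J. is_complement I J"
    using ex_sentence[of "maximal_word I" "\<lambda>i. \<not> separated I i"]
    by (simp add: is_complement_def sentence_size_def)
next
  fix J K assume "is_complement I J" "is_complement I K"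
  then show "J = K"
    by (intro sentence_eqI) (auto simp: is_complement_def sentence_size_def)
qed

end

theory Submission
  imports Defs
begin

text \<open>On the monomial basis the antipode is \<open>M I \<mapsto> (-1)\<^sup>\<ell> (\<Sum>P. M (rev P))\<close>, where \<open>\<ell>\<close> is the number of words
  of \<open>I\<close> and \<open>P\<close> runs over the coarsenings of \<open>I\<close>: both convolution identities reduce to a
  telescoping sum over the deconcatenations of \<open>I\<close>, and the left identity alone determines the
  antipode recursively.
  A sentence with a given maximal word \<open>w\<close> of length \<open>n > 0\<close> amounts to a subset of \<open>{1, \<dots>, n - 1}\<close>,
  its set of cuts; refinement is inclusion of cuts and \<open>\<ell>\<close> is one more than the number of cuts. So the
  coefficient of \<open>M (rev K)\<close> in the antipode of \<open>F I\<close> is an alternating sum over the supersets of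
  \<open>cuts I \<union> cuts K\<close>. It vanishes unless this union is all of \<open>{1, \<dots>, n - 1}\<close>, that is,
  unless \<open>K\<close> refines the complement of \<open>I\<close>.\<close>

section \<open>Linear extensions and the convolution product\<close>

lemma lookup_scale [simp]: "Poly_Mapping.lookup (scale c p) b = c * Poly_Mapping.lookup p b"
  unfolding scale_def by (subst map.rep_eq) (simp add: when_def)

interpretation pm: vector_space "scale :: 'k::field \<Rightarrow> ('b \<Rightarrow>\<^sub>0 'k) \<Rightarrow> _"
  by standard (auto intro!: poly_mapping_eqI simp: lookup_add algebra_simps)

interpretation pmp: vector_space_pair
  "scale :: 'k::field \<Rightarrow> ('b \<Rightarrow>\<^sub>0 'k) \<Rightarrow> _" "scale :: 'k \<Rightarrow> ('c \<Rightarrow>\<^sub>0 'k) \<Rightarrow> _"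
  by unfold_locales

abbreviation lin :: "(('b \<Rightarrow>\<^sub>0 'k) \<Rightarrow> ('c \<Rightarrow>\<^sub>0 'k::field)) \<Rightarrow> bool" where
  "lin \<equiv> Vector_Spaces.linear scale scale"

lemma linI:
  assumes "\<And>p q. f (p + q) = f p + f q" "\<And>c p. f (scale c p) = scale c (f p)"
  shows "lin f"
  unfolding Vector_Spaces.linear_iff using assms by (simp add: pm.vector_space_axioms)

lemma lin_compose: "lin f \<Longrightarrow> lin g \<Longrightarrow> lin (\<lambda>p. g (f p))"
  using Vector_Spaces.linear_compose by (fastforce simp: o_def)

text \<open>Keys outside the support of \<open>p\<close> have coefficient zero, so vectors with
  different supports can be expanded over one common finite set.\<close>

lemma lin_extend_superset:
  assumes "finite B" "Poly_Mapping.keys p \<subseteq> B"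
  shows "lin_extend f p = (\<Sum>b\<in>B. scale (Poly_Mapping.lookup p b) (f b))"
  unfolding lin_extend_def
  by (rule sum.mono_neutral_left) (use assms in \<open>auto simp: in_keys_iff\<close>)

lemma lin_lin_extend:
  fixes f :: "'b \<Rightarrow> ('c \<Rightarrow>\<^sub>0 'k::field)"
  shows "lin (lin_extend f)"
proof (rule linI)
  fix p q :: "'b \<Rightarrow>\<^sub>0 'k"
  let ?B = "Poly_Mapping.keys p \<union> Poly_Mapping.keys q"
  have "lin_extend f (p + q) = (\<Sum>b\<in>?B. scale (Poly_Mapping.lookup (p + q) b) (f b))"
    by (rule lin_extend_superset) (auto simp: in_keys_iff lookup_add)
  also have "\<dots> = lin_extend f p + lin_extend f q"
    by (simp add: lin_extend_superset[of ?B p] lin_extend_superset[of ?B q] lookup_add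
        pm.scale_left_distrib sum.distrib)
  finally show "lin_extend f (p + q) = lin_extend f p + lin_extend f q" .
next
  fix c and p :: "'b \<Rightarrow>\<^sub>0 'k"
  have "lin_extend f (scale c p)
      = (\<Sum>b\<in>Poly_Mapping.keys p. scale (Poly_Mapping.lookup (scale c p) b) (f b))"
    by (rule lin_extend_superset) (auto simp: in_keys_iff)
  then show "lin_extend f (scale c p) = scale c (lin_extend f p)"
    by (simp add: lin_extend_def pm.scale_sum_right)
qed

lemma lin_extend_single [simp]: "lin_extend f (Poly_Mapping.single b 1) = f b"
  by (simp add: lin_extend_def)

lemma lin_extend_M [simp]: "lin_extend f (M I) = f I"
  by (simp add: M_def)

lemma lin_extend_single_id: "lin_extend (\<lambda>b. Poly_Mapping.single b 1) p = p"
proof -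
  have "scale c (Poly_Mapping.single b 1) = Poly_Mapping.single b c" for c :: 'b and b :: 'a
    by (intro poly_mapping_eqI) (simp add: lookup_single when_def)
  then have "lin_extend (\<lambda>b. Poly_Mapping.single b 1) p =
      (\<Sum>b\<in>Poly_Mapping.keys p. Poly_Mapping.single b (Poly_Mapping.lookup p b))"
    by (simp add: lin_extend_def)
  also have "\<dots> = p"
    by (intro poly_mapping_eqI)
      (auto simp: lookup_sum lookup_single when_def in_keys_iff sum.delta')
  finally show ?thesis .
qed

lemma lin_apply_lin_extend: "lin f \<Longrightarrow> f (lin_extend g p) = lin_extend (\<lambda>b. f (g b)) p"
  by (simp add: lin_extend_def pmp.linear_sum pmp.linear_scale)

lemma lin_eq_lin_extend: "lin f \<Longrightarrow> f p = lin_extend (\<lambda>b. f (Poly_Mapping.single b 1)) p"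
  using lin_apply_lin_extend[of f "\<lambda>b. Poly_Mapping.single b 1" p]
  by (simp add: lin_extend_single_id)

lemma lin_eqI:
  assumes "lin f" "lin g" "\<And>b. f (Poly_Mapping.single b 1) = g (Poly_Mapping.single b 1)"
  shows "f = g"
proof
  fix p
  have "f p = lin_extend (\<lambda>b. f (Poly_Mapping.single b 1)) p"
    by (rule lin_eq_lin_extend[OF assms(1)])
  also have "\<dots> = g p"
    unfolding assms(3) by (rule lin_eq_lin_extend[OF assms(2), symmetric])
  finally show "f p = g p" .
qed

section \<open>Bilinearity of the tensor product and of the multiplication\<close>

lemma tensor_lin_extend_left:
  "tensor p q = lin_extend (\<lambda>I. lin_extend (\<lambda>J. Poly_Mapping.single (I, J) 1) q) p"
  unfolding tensor_def lin_extend_def pm.scale_sum_right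
  by (intro sum.cong refl poly_mapping_eqI) (simp add: lookup_single when_def)

text \<open>Exchanging the two sums exhibits \<open>tensor\<close> as a linear extension in its
  second factor as well, so \<open>lin_lin_extend\<close> gives linearity on both sides.\<close>

lemma tensor_lin_extend_right:
  "tensor p q = lin_extend (\<lambda>J. lin_extend (\<lambda>I. Poly_Mapping.single (I, J) 1) p) q"
  unfolding tensor_def lin_extend_def pm.scale_sum_right
  by (subst sum.swap, intro sum.cong refl poly_mapping_eqI) (simp add: lookup_single when_def)

lemma lin_tensor_left: "lin (\<lambda>p. tensor p q)"
  unfolding tensor_lin_extend_left by (rule lin_lin_extend)

lemma lin_tensor_right: "lin (tensor p)"
  unfolding tensor_lin_extend_right[abs_def] by (rule lin_lin_extend)

lemma tensor_M: "tensor (M I) (M J) = Poly_Mapping.single (I, J) 1"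
  by (simp add: tensor_lin_extend_left)

definition qprod :: "('a, 'k) qsym \<Rightarrow> ('a, 'k) qsym \<Rightarrow> ('a, 'k::field) qsym" where
  "qprod p q = qmult (tensor p q)"

lemma lin_qmult: "lin qmult" unfolding qmult_def by (rule lin_lin_extend)

lemma lin_qprod_left: "lin (\<lambda>p. qprod p q)"
  unfolding qprod_def by (rule lin_compose[OF lin_tensor_left lin_qmult])

lemma lin_qprod_right: "lin (qprod p)"
  unfolding qprod_def[abs_def] by (rule lin_compose[OF lin_tensor_right lin_qmult])

lemma qprod_M: "qprod (M I) (M J) = (\<Sum>K\<in>#quasi_shuffle I J. M K)"
  by (simp add: qprod_def tensor_M qmult_def)

lemma qprod_unit: "qprod p (M []) = p"
proof -
  have "(\<lambda>p. qprod p (M [])) = (\<lambda>p. p)"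
    by (rule lin_eqI[OF lin_qprod_left pm.linear_ident])
      (simp add: M_def[symmetric] qprod_M)
  then show ?thesis by metis
qed

section \<open>Convolution and uniqueness of the antipode\<close>

definition convolution where
  "convolution S T p = qmult (tensor_map S T (qcomult p))"

lemma lin_convolution: "lin (convolution S T)"
  unfolding convolution_def[abs_def] tensor_map_def qcomult_def
  by (intro lin_compose[OF _ lin_qmult] lin_compose[OF lin_lin_extend] lin_lin_extend)

lemma convolution_M:
  "convolution S T (M I) = (\<Sum>(J, K)\<in>{(J, K). J @ K = I}. qprod (S (M J)) (T (M K)))"
proof -
  have L: "lin (\<lambda>p. qmult (tensor_map S T p))"
    unfolding tensor_map_def by (rule lin_compose[OF lin_lin_extend lin_qmult])
  show ?thesis
    by (simp add: convolution_def qcomult_def pmp.linear_sum[OF L] case_prod_unfold tensor_M)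
       (simp add: tensor_map_def qprod_def case_prod_unfold)
qed

text \<open>Both sides of each antipode axiom are linear in \<open>p\<close>, so they only have to
  be compared on the basis.\<close>

lemma is_antipode_iff:
  "is_antipode S \<longleftrightarrow> lin S \<and>
     (\<forall>I. convolution S id (M I) = qunit (qcounit (M I))) \<and>
     (\<forall>I. convolution id S (M I) = qunit (qcounit (M I)))"
proof -
  have "lin (\<lambda>p. qunit (qcounit p) :: ('a,'b) qsym)"
    by (rule linI) 
      (auto simp: qunit_def qcounit_def lookup_add pm.scale_left_distrib)
  then have "(\<forall>p. convolution S T p = qunit (qcounit p)) \<longleftrightarrow>
     (\<forall>I. convolution S T (M I) = qunit (qcounit (M I)))" for S T :: "('a,'b) qsym \<Rightarrow> ('a,'b) qsym"
    using lin_eqI[OF lin_convolution, of "\<lambda>p. qunit (qcounit p)" S T] unfolding M_def by metis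
  then show ?thesis unfolding is_antipode_def convolution_def[symmetric] by simp
qed

lemma antipode_unique:
  assumes "is_antipode S" "is_antipode T" shows "S = T"
proof (rule lin_eqI)
  show "lin S" "lin T" using assms by (auto simp: is_antipode_def)
  have "S (M I) = T (M I)" for I
  proof (induction I rule: length_induct)
    case (1 I)
    let ?D = "{(J, K). J @ K = I}"
    \<comment> \<open>The deconcatenation with empty second part contributes \<open>U (M I)\<close>
      itself, since \<open>M []\<close> is a right unit; all others apply \<open>U\<close> only to
      shorter sentences.\<close>
    have split: "convolution U id (M I) =
        U (M I) + (\<Sum>(J, K)\<in>?D - {(I, [])}. qprod (U (M J)) (M K))"
      for U :: "('a, 'b) qsym \<Rightarrow> ('a, 'b) qsym"
      unfolding convolution_M
      by (subst sum.remove[of _ "(I, [])"]) (auto simp: finite_deconcatenations qprod_unit)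
    have "(\<Sum>(J, K)\<in>?D - {(I, [])}. qprod (S (M J)) (M K)) =
        (\<Sum>(J, K)\<in>?D - {(I, [])}. qprod (T (M J)) (M K))"
    proof (intro sum.cong refl)
      fix x assume "x \<in> ?D - {(I, [])}"
      then obtain J K where x: "x = (J, K)" "I = J @ K" "K \<noteq> []" by auto
      then have "length J < length I" by simp
      with 1 x show "(case x of (J, K) \<Rightarrow> qprod (S (M J)) (M K)) =
          (case x of (J, K) \<Rightarrow> qprod (T (M J)) (M K))" by simp
    qed
    moreover have "convolution S id (M I) = convolution T id (M I)"
      using assms by (simp add: is_antipode_iff)
    ultimately show ?case unfolding split by simp
  qed
  then show "S (Poly_Mapping.single I 1) = T (Poly_Mapping.single I 1)" for I
    by (simp add: M_def)
qed

lemma antipode_eqI: "is_antipode S \<Longrightarrow> antipode = S"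
  unfolding antipode_def by (rule the_equality) (auto intro: antipode_unique)

section \<open>Quasi-shuffles and coarsenings\<close>

lemma quasi_shuffle_Nil_left [simp]: "quasi_shuffle [] J = {#J#}"
  by (cases J) auto

lemma letters_word_append [simp]: "letters (word_append u v) = letters u @ letters v"
  by (simp add: word_append_def Word_inverse)

text \<open>Peeling first words, as in the defining recursion, commutes with peeling last words. The
  joined word is \<open>word_append u v\<close> at either end, which makes quasi-shuffles compatible
  with reversal.\<close>

lemma quasi_shuffle_snoc:
  "quasi_shuffle (I @ [u]) (J @ [v]) =
     image_mset (\<lambda>K. K @ [u]) (quasi_shuffle I (J @ [v])) +
     image_mset (\<lambda>K. K @ [v]) (quasi_shuffle (I @ [u]) J) +
     image_mset (\<lambda>K. K @ [word_append u v]) (quasi_shuffle I J)"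
proof (induction I J rule: quasi_shuffle.induct)
  case (1 I)
  show ?case by (induction I) (auto simp: multiset.map_comp o_def ac_simps)
next
  case (2 w J)
  show ?case by (induction J arbitrary: w) (auto simp: multiset.map_comp o_def ac_simps)
next
  case (3 x I y J)
  then show ?case by (auto simp: multiset.map_comp o_def ac_simps)
qed

lemma quasi_shuffle_rev:
  "quasi_shuffle (rev I) (rev J) = image_mset rev (quasi_shuffle I J)"
  by (induction I J rule: quasi_shuffle.induct)
    (auto simp: quasi_shuffle_snoc multiset.map_comp o_def)

section \<open>Recursion for coarsenings at either end\<close>

lemma Nil_neq_letters [simp]: "[] \<noteq> letters w"
  using letters_nonempty by metis

lemma refines_iff_Nil [simp]: "refines [] P \<longleftrightarrow> P = []"
  unfolding refines_def by (cases P) (auto intro: exI[of _ "[]"])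

text \<open>The group containing \<open>k\<close> either is \<open>[k]\<close> or has further words;
  deleting \<open>k\<close> leaves a grouping of \<open>K\<close>. Both kinds of coarsening are
  parametrised by the same \<open>Q\<close>, so that sums over them can be merged.\<close>

lemma refines_Cons:
  "refines (k # K) P \<longleftrightarrow> (\<exists>Q. refines K Q \<and>
     (P = k # Q \<or> Q \<noteq> [] \<and> P = word_append k (hd Q) # tl Q))"
proof
  assume "refines (k # K) P"
  then obtain G where G: "concat G = k # K" "map maximal_word G = map letters P"
    by (auto simp: refines_def)
  then obtain g G' where g: "G = g # G'" by (cases G) auto
  with G obtain p P' where p: "P = p # P'" "maximal_word g = letters p" by (cases P) auto
  then obtain g' where g': "g = k # g'" using G g by (cases g) auto
  show "\<exists>Q. refines K Q \<and> (P = k # Q \<or> Q \<noteq> [] \<and> P = word_append k (hd Q) # tl Q)"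
  proof (cases "g' = []")
    case True
    then have "letters p = letters k" using p g' by simp
    then have "P = k # P'" by (simp add: letters_inject p)
    moreover have "refines K P'" unfolding refines_def using True G g g' p by auto
    ultimately show ?thesis by blast
  next
    case False
    \<comment> \<open>The rest of the first group, which is non-empty here, becomes the first word
      of the coarsening of \<open>K\<close>.\<close>
    let ?q = "Word (maximal_word g')"
    have q: "letters ?q = maximal_word g'" using False by (simp add: Word_inverse)
    then have "letters p = letters (word_append k ?q)" using p g' by simp
    then have "P = word_append k ?q # P'" unfolding letters_inject by (simp add: p)
    moreover have "refines K (?q # P')" unfolding refines_def using G g g' p q
      by (intro exI[of _ "g' # G'"]) auto
    ultimately show ?thesis by force
  qed
next
  assume "\<exists>Q. refines K Q \<and> (P = k # Q \<or> Q \<noteq> [] \<and> P = word_append k (hd Q) # tl Q)"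
  then obtain G Q where "concat G = K" "map maximal_word G = map letters Q"
    "P = k # Q \<or> Q \<noteq> [] \<and> P = word_append k (hd Q) # tl Q"
    by (auto simp: refines_def)
  moreover then have "G \<noteq> []" if "Q \<noteq> []" using that by auto
  ultimately show "refines (k # K) P" unfolding refines_def
    by (elim disjE, intro exI[of _ "[k] # G"], simp)
      (intro exI[of _ "(k # hd G) # tl G"], cases G; cases Q; auto)
qed

lemma refines_snoc:
  "refines (K @ [k]) P \<longleftrightarrow> (\<exists>Q. refines K Q \<and>
     (P = Q @ [k] \<or> Q \<noteq> [] \<and> P = butlast Q @ [word_append (last Q) k]))"
proof
  assume "refines (K @ [k]) P"
  then obtain G where G: "concat G = K @ [k]" "map maximal_word G = map letters P"
    by (auto simp: refines_def)
  then obtain g G' where g: "G = G' @ [g]" by (cases G rule: rev_cases) auto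
  with G obtain p P' where p: "P = P' @ [p]" "maximal_word g = letters p"
    by (cases P rule: rev_cases) auto
  then obtain g' where g': "g = g' @ [k]" using G g by (cases g rule: rev_cases) auto
  show "\<exists>Q. refines K Q \<and> (P = Q @ [k] \<or> Q \<noteq> [] \<and> P = butlast Q @ [word_append (last Q) k])"
  proof (cases "g' = []")
    case True
    then have "letters p = letters k" using p g' by simp
    then have "P = P' @ [k]" by (simp add: letters_inject p)
    moreover have "refines K P'" unfolding refines_def using True G g g' p by auto
    ultimately show ?thesis by blast
  next
    case False
    let ?q = "Word (maximal_word g')"
    have q: "letters ?q = maximal_word g'" using False by (simp add: Word_inverse)
    then have "letters p = letters (word_append ?q k)" using p g' by simp
    then have "P = P' @ [word_append ?q k]" unfolding letters_inject by (simp add: p)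
    moreover have "refines K (P' @ [?q])" unfolding refines_def using G g g' p q
      by (intro exI[of _ "G' @ [g']"]) auto
    ultimately show ?thesis by force
  qed
next
  assume "\<exists>Q. refines K Q \<and> (P = Q @ [k] \<or> Q \<noteq> [] \<and> P = butlast Q @ [word_append (last Q) k])"
  then obtain G Q where "concat G = K" "map maximal_word G = map letters Q"
    "P = Q @ [k] \<or> Q \<noteq> [] \<and> P = butlast Q @ [word_append (last Q) k]"
    by (auto simp: refines_def)
  moreover then have "G \<noteq> []" if "Q \<noteq> []" using that by auto
  ultimately show "refines (K @ [k]) P" unfolding refines_def
    by (elim disjE, intro exI[of _ "G @ [[k]]"], simp)
      (intro exI[of _ "butlast G @ [last G @ [k]]"], cases G rule: rev_cases; cases Q rule: rev_cases; auto)
qed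

lemma finite_coarsenings: "finite {P. refines K P}"
  by (rule finite_subset[OF _ finite_maximal_word[of "maximal_word K"]])
    (auto dest: refines_maximal_word)

lemma word_append_neq [simp]: "u \<noteq> word_append u v" "v \<noteq> word_append u v"
  by (metis append_self_conv letters_nonempty letters_word_append)
    (metis append_self_conv2 letters_nonempty letters_word_append)

lemma word_append_cancel [simp]:
  "word_append u v = word_append u w \<longleftrightarrow> v = w" "word_append v u = word_append w u \<longleftrightarrow> v = w"
  by (metis letters_inject letters_word_append same_append_eq append_same_eq)+

text \<open>The two families are disjoint because \<open>k\<close> differs from every word it is a
  proper prefix of, and joining \<open>k\<close> is injective by cancellation. The value 0 at
  \<open>Q = []\<close> gives both families the same index set.\<close>

lemma sum_coarsenings_Cons:
  "(\<Sum>P | refines (k # K) P. f P) = (\<Sum>Q | refines K Q.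
     f (k # Q) + (if Q = [] then 0 else f (word_append k (hd Q) # tl Q)))"
proof -
  let ?C = "{Q. refines K Q}" and ?m = "\<lambda>Q. word_append k (hd Q) # tl Q"
  have "{P. refines (k # K) P} = (#) k ` ?C \<union> ?m ` (?C - {[]})"
    by (auto simp: refines_Cons)
  moreover have "inj_on ?m (?C - {[]})"
    by (rule inj_onI) (auto simp: hd_Cons_tl intro: list.expand)
  ultimately have "(\<Sum>P | refines (k # K) P. f P) =
      (\<Sum>Q\<in>?C. f (k # Q)) + (\<Sum>Q\<in>?C - {[]}. f (?m Q))"
    by (simp, subst sum.union_disjoint) (auto simp: finite_coarsenings sum.reindex)
  also have "(\<Sum>Q\<in>?C - {[]}. f (?m Q)) = (\<Sum>Q\<in>?C. if Q = [] then 0 else f (?m Q))"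
    by (rule sum.mono_neutral_cong_left) (auto simp: finite_coarsenings)
  finally show ?thesis by (simp add: sum.distrib)
qed

lemma sum_coarsenings_snoc:
  "(\<Sum>P | refines (K @ [k]) P. f P) = (\<Sum>Q | refines K Q.
     f (Q @ [k]) + (if Q = [] then 0 else f (butlast Q @ [word_append (last Q) k])))"
proof -
  let ?C = "{Q. refines K Q}" and ?m = "\<lambda>Q. butlast Q @ [word_append (last Q) k]"
  have "{P. refines (K @ [k]) P} = (\<lambda>Q. Q @ [k]) ` ?C \<union> ?m ` (?C - {[]})"
    by (auto simp: refines_snoc)
  moreover have "inj_on ?m (?C - {[]})"
    by (rule inj_onI) (metis DiffD2 append_butlast_last_id append1_eq_conv insertI1 word_append_cancel(2))
  ultimately have "(\<Sum>P | refines (K @ [k]) P. f P) =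
      (\<Sum>Q\<in>?C. f (Q @ [k])) + (\<Sum>Q\<in>?C - {[]}. f (?m Q))"
    by (simp, subst sum.union_disjoint) (auto simp: finite_coarsenings sum.reindex inj_on_def)
  also have "(\<Sum>Q\<in>?C - {[]}. f (?m Q)) = (\<Sum>Q\<in>?C. if Q = [] then 0 else f (?m Q))"
    by (rule sum.mono_neutral_cong_left) (auto simp: finite_coarsenings)
  finally show ?thesis by (simp add: sum.distrib)
qed

section \<open>Sums over quasi-shuffles and over deconcatenations\<close>

definition qs_sum :: "('a sentence \<Rightarrow> 'b::comm_monoid_add) \<Rightarrow> 'a sentence \<Rightarrow> 'a sentence \<Rightarrow> 'b" where
  "qs_sum g X Y = (\<Sum>Z\<in>#quasi_shuffle X Y. g Z)"

lemma qs_sum_Nil [simp]: "qs_sum g X [] = g X" "qs_sum g [] X = g X"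
  by (simp_all add: qs_sum_def)

lemma qs_sum_Cons:
  "qs_sum g (u # X) (v # Y) = qs_sum (\<lambda>Z. g (u # Z)) X (v # Y) +
     qs_sum (\<lambda>Z. g (v # Z)) (u # X) Y + qs_sum (\<lambda>Z. g (word_append u v # Z)) X Y"
  by (simp add: qs_sum_def multiset.map_comp o_def)

lemma qs_sum_rev: "qs_sum g (rev X) (rev Y) = qs_sum (\<lambda>Z. g (rev Z)) X Y"
  by (simp add: qs_sum_def quasi_shuffle_rev multiset.map_comp o_def)

lemma sum_splits_Nil: "(\<Sum>(J, K)\<in>{(J, K). J @ K = []}. h J K) = h [] []"
proof -
  have "{(J, K). J @ K = []} = {([], [])}" by auto
  then show ?thesis by simp
qed

lemma sum_splits_Cons:
  "(\<Sum>(J, K)\<in>{(J, K). J @ K = x # I}. h J K) =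
     h [] (x # I) + (\<Sum>(J, K)\<in>{(J, K). J @ K = I}. h (x # J) K)"
proof -
  have eq: "{(J, K). J @ K = x # I} =
      insert ([], x # I) ((\<lambda>(J, K). (x # J, K)) ` {(J, K). J @ K = I})"
    by (auto simp: Cons_eq_append_conv append_eq_Cons_conv image_iff)
  have inj: "inj_on (\<lambda>(J, K). (x # J, K)) {(J, K). J @ K = I}"
    by (auto intro: inj_onI)
  show ?thesis
    unfolding eq by (subst sum.insert, intro finite_imageI finite_deconcatenations)
      (auto simp: sum.reindex[OF inj[unfolded case_prod_unfold]] case_prod_unfold)
qed

lemma sum_splits_snoc:
  "(\<Sum>(J, K)\<in>{(J, K). J @ K = I @ [x]}. h J K) =
     h (I @ [x]) [] + (\<Sum>(J, K)\<in>{(J, K). J @ K = I}. h J (K @ [x]))"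
proof -
  have eq: "{(J, K). J @ K = I @ [x]} =
      insert (I @ [x], []) ((\<lambda>(J, K). (J, K @ [x])) ` {(J, K). J @ K = I})"
  proof (intro equalityI subsetI)
    fix p assume "p \<in> {(J, K). J @ K = I @ [x]}"
    then obtain J K where "p = (J, K)" "J @ K = I @ [x]" by auto
    then show "p \<in> insert (I @ [x], []) ((\<lambda>(J, K). (J, K @ [x])) ` {(J, K). J @ K = I})"
      by (cases K rule: rev_cases) auto
  qed auto
  have inj: "inj_on (\<lambda>(J, K). (J, K @ [x])) {(J, K). J @ K = I}"
    by (auto intro: inj_onI)
  show ?thesis
    unfolding eq by (subst sum.insert, intro finite_imageI finite_deconcatenations)
      (auto simp: sum.reindex[OF inj[unfolded case_prod_unfold]] case_prod_unfold)
qed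

lemma refines_Nil_right: "refines K [] \<longleftrightarrow> K = []"
  by (cases K) (auto simp: refines_Cons)

lemma coarsenings_Nil [simp]: "Collect (refines []) = {[]}"
  by auto

text \<open>The telescoping argument: every sentence in the quasi-shuffle of \<open>rev P\<close> and \<open>k # K\<close> starts with
  the last word \<open>p\<close> of \<open>P\<close>, with \<open>k\<close>, or with \<open>p k\<close>. The function \<open>left_head\<close> collects the contributions
  of the first kind; those of the other two kinds for the deconcatenation \<open>(J, k # K)\<close> are exactly the
  ones of the first kind for \<open>(J @ [k], K)\<close>. Values are taken through an arbitrary \<open>g\<close> so that first
  words can be absorbed into it.\<close>

definition left_term :: "('a sentence \<Rightarrow> 'b::comm_monoid_add) \<Rightarrow> 'a sentence \<Rightarrow> 'a sentence \<Rightarrow> 'b" where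
  "left_term g J K = (\<Sum>P | refines J P. qs_sum g (rev P) K)"

definition left_head :: "('a sentence \<Rightarrow> 'b::comm_monoid_add) \<Rightarrow> 'a sentence \<Rightarrow> 'a sentence \<Rightarrow> 'b" where
  "left_head g J K = (\<Sum>P | refines J P.
     if P = [] then 0 else qs_sum (\<lambda>Z. g (last P # Z)) (rev (butlast P)) K)"

lemma left_term_Cons: "left_term g J (k # K) = left_head g J (k # K) + left_head g (J @ [k]) K"
  unfolding left_term_def left_head_def sum_coarsenings_snoc sum.distrib[symmetric]
proof (rule sum.cong[OF refl])
  fix P
  show "qs_sum g (rev P) (k # K) =
    (if P = [] then 0 else qs_sum (\<lambda>Z. g (last P # Z)) (rev (butlast P)) (k # K)) +
    ((if P @ [k] = [] then 0
      else qs_sum (\<lambda>Z. g (last (P @ [k]) # Z)) (rev (butlast (P @ [k]))) K) +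
     (if P = [] then 0
      else if butlast P @ [word_append (last P) k] = [] then 0
      else qs_sum (\<lambda>Z. g (last (butlast P @ [word_append (last P) k]) # Z))
        (rev (butlast (butlast P @ [word_append (last P) k]))) K))"
    \<comment> \<open>For \<open>P = []\<close> only the coarsening \<open>[k]\<close> contributes.
      Otherwise the three summands are those of \<open>qs_sum_Cons\<close>, as \<open>rev P\<close>
      starts with \<open>last P\<close>.\<close>
    by (cases P rule: rev_cases) (simp_all add: qs_sum_Cons butlast_append ac_simps)
qed

lemma left_term_Nil: "J \<noteq> [] \<Longrightarrow> left_term g J [] = left_head g J []"
  unfolding left_term_def left_head_def
proof (rule sum.cong[OF refl])
  fix P assume "J \<noteq> []" "P \<in> {P. refines J P}"
  then have "P \<noteq> []" by (auto simp: refines_Nil_right)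
  then show "qs_sum g (rev P) [] =
      (if P = [] then 0 else qs_sum (\<lambda>Z. g (last P # Z)) (rev (butlast P)) [])"
    by (cases P rule: rev_cases) auto
qed

text \<open>The prefix \<open>L\<close> holds the words already moved to the left. For
  \<open>k # I\<close>, the split with \<open>J = []\<close> gives
  \<open>left_head g L (k # I) + left_head g (L @ [k]) I\<close>; the other splits carry one more
  sign and sum to minus the second term. The excluded case \<open>L = I = []\<close> is the one with
  a non-trivial counit: there the sum is \<open>g []\<close>, but the head is 0.\<close>

lemma left_telescope:
  assumes "L @ I \<noteq> []"
  shows "(\<Sum>(J, K)\<in>{(J, K). J @ K = I}. scale ((-1) ^ length J) (left_term g (L @ J) K)) =
    left_head g L I"
  using assms
proof (induction I arbitrary: L)
  case Nil
  then show ?case by (simp add: sum_splits_Nil left_term_Nil)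
next
  case (Cons k I)
  show ?case
    using Cons.IH[of "L @ [k]"]
    by (subst sum_splits_Cons) (simp add: left_term_Cons sum_negf case_prod_unfold)
qed

text \<open>Here the cancellation takes place at the last word of the quasi-shuffle, so everything is
  reversed first and \<open>g\<close> will be instantiated with a function that undoes the reversal.\<close>

definition right_term :: "('a sentence \<Rightarrow> 'b::comm_monoid_add) \<Rightarrow> 'a sentence \<Rightarrow> 'a sentence \<Rightarrow> 'b" where
  "right_term g J K = (\<Sum>P | refines K P. qs_sum g (rev J) P)"

definition right_head :: "('a sentence \<Rightarrow> 'b::comm_monoid_add) \<Rightarrow> 'a sentence \<Rightarrow> 'a sentence \<Rightarrow> 'b" where
  "right_head g J K = (\<Sum>P | refines K P.
     if P = [] then 0 else qs_sum (\<lambda>Z. g (hd P # Z)) (rev J) (tl P))"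

lemma right_term_snoc: "right_term g (J @ [j]) K = right_head g (J @ [j]) K + right_head g J (j # K)"
  unfolding right_term_def right_head_def sum_coarsenings_Cons sum.distrib[symmetric]
proof (rule sum.cong[OF refl])
  fix P
  show "qs_sum g (rev (J @ [j])) P =
    (if P = [] then 0 else qs_sum (\<lambda>Z. g (hd P # Z)) (rev (J @ [j])) (tl P)) +
    ((if j # P = [] then 0 else qs_sum (\<lambda>Z. g (hd (j # P) # Z)) (rev J) (tl (j # P))) +
     (if P = [] then 0
      else if word_append j (hd P) # tl P = [] then 0
      else qs_sum (\<lambda>Z. g (hd (word_append j (hd P) # tl P) # Z)) (rev J)
        (tl (word_append j (hd P) # tl P))))"
    by (cases P) (simp_all add: qs_sum_Cons ac_simps)
qed

lemma right_term_Nil: "K \<noteq> [] \<Longrightarrow> right_term g [] K = right_head g [] K"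
  unfolding right_term_def right_head_def
proof (rule sum.cong[OF refl])
  fix P assume "K \<noteq> []" "P \<in> {P. refines K P}"
  then have "P \<noteq> []" by (auto simp: refines_Nil_right)
  then show "qs_sum g (rev []) P =
      (if P = [] then 0 else qs_sum (\<lambda>Z. g (hd P # Z)) (rev []) (tl P))"
    by simp
qed

text \<open>Mirror image of \<open>left_telescope\<close>: the last word of \<open>I\<close> moves
  to the front of the suffix \<open>R\<close>.\<close>

lemma right_telescope:
  assumes "I @ R \<noteq> []"
  shows "(\<Sum>(J, K)\<in>{(J, K). J @ K = I}. scale ((-1) ^ length K) (right_term g J (K @ R))) =
    right_head g I R"
  using assms
proof (induction I arbitrary: R rule: rev_induct)
  case Nil
  then show ?case by (simp add: sum_splits_Nil right_term_Nil)
next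
  case (snoc j I)
  show ?case
    using snoc.IH[of "j # R"]
    by (subst sum_splits_snoc) (simp add: right_term_snoc sum_negf case_prod_unfold)
qed

section \<open>The antipode on the monomial basis\<close>

definition qsym_antipode :: "('a, 'k) qsym \<Rightarrow> ('a, 'k::field) qsym" where
  "qsym_antipode = lin_extend (\<lambda>I. scale ((-1) ^ length I) (\<Sum>P | refines I P. M (rev P)))"

lemma qsym_antipode_M:
  "qsym_antipode (M I) = scale ((-1) ^ length I) (\<Sum>P | refines I P. M (rev P))"
  by (simp add: qsym_antipode_def)

lemma lin_qsym_antipode: "lin qsym_antipode"
  unfolding qsym_antipode_def by (rule lin_lin_extend)

lemma qprod_antipode_left:
  "qprod (qsym_antipode (M J)) (M K) = scale ((-1) ^ length J) (left_term M J K)"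
  by (simp add: qsym_antipode_M pmp.linear_scale[OF lin_qprod_left]
      pmp.linear_sum[OF lin_qprod_left] qprod_M left_term_def qs_sum_def)

lemma qprod_antipode_right:
  "qprod (M J) (qsym_antipode (M K) :: ('a, 'k::field) qsym) =
    scale ((-1) ^ length K) (right_term (\<lambda>Z. M (rev Z)) J K)"
proof -
  \<comment> \<open>Reversing both arguments removes the reversal from \<open>P\<close>; the
    function \<open>M (rev Z)\<close> compensates for it.\<close>
  have "qs_sum M J (rev P) = (qs_sum (\<lambda>Z. M (rev Z)) (rev J) P :: ('a, 'k) qsym)" for P
    using qs_sum_rev[of M "rev J" P] by simp
  then show ?thesis
    by (simp add: qsym_antipode_M pmp.linear_scale[OF lin_qprod_right]
      pmp.linear_sum[OF lin_qprod_right] qprod_M right_term_def qs_sum_def[of M, symmetric])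
qed

lemma is_antipode_qsym_antipode: "is_antipode qsym_antipode"
proof -
  have counit: "qunit (qcounit (M I)) = (if I = [] then M [] else 0 :: ('a, 'b) qsym)"
    for I :: "'a sentence"
    by (auto simp: qunit_def qcounit_def M_def lookup_single)
  have "convolution qsym_antipode id (M I) = (qunit (qcounit (M I)) :: ('a, 'b) qsym)"
    "convolution id qsym_antipode (M I) = (qunit (qcounit (M I)) :: ('a, 'b) qsym)"
    for I :: "'a sentence"
  proof -
    show "convolution qsym_antipode id (M I) = (qunit (qcounit (M I)) :: ('a, 'b) qsym)"
    proof (cases "I = []")
      case True
      then show ?thesis
        by (simp add: counit convolution_M sum_splits_Nil qprod_antipode_left left_term_def)
    next
      case False
      \<comment> \<open>With \<open>L = []\<close> the telescoped sum is
        \<open>left_head M [] I\<close>, which vanishes because \<open>[]\<close> is the only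
        coarsening of \<open>[]\<close>.\<close>
      then show ?thesis
        using left_telescope[of "[]" I "M :: 'a sentence \<Rightarrow> ('a, 'b) qsym"]
        by (simp add: counit convolution_M qprod_antipode_left left_head_def)
    qed
    show "convolution id qsym_antipode (M I) = (qunit (qcounit (M I)) :: ('a, 'b) qsym)"
    proof (cases "I = []")
      case True
      then show ?thesis
        by (simp add: counit convolution_M sum_splits_Nil qprod_antipode_right right_term_def)
    next
      case False
      \<comment> \<open>Likewise the head vanishes for the empty suffix
        \<open>R = []\<close>.\<close>
      then show ?thesis
        using right_telescope[of I "[]" "\<lambda>Z. M (rev Z) :: ('a, 'b) qsym"]
        by (simp add: counit convolution_M qprod_antipode_right right_head_def)
    qed
  qed
  then show ?thesis by (simp add: is_antipode_iff lin_qsym_antipode)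
qed

lemma antipode_eq: "antipode = qsym_antipode"
  by (rule antipode_eqI[OF is_antipode_qsym_antipode])

section \<open>Cuts\<close>

definition cuts :: "'a sentence \<Rightarrow> nat set" where "cuts I = {i. separated I i}"

lemma cuts_Nil [simp]: "cuts [] = {}" by (simp add: cuts_def)

lemma cuts_Cons:
  "cuts (w # I) = (if I = [] then {} else insert (length (letters w)) ((+) (length (letters w)) ` cuts I))"
proof -
  \<comment> \<open>The strict \<open>n < i\<close> describes the shifted cuts only because position
    0 is never a cut; the cut right after the first word is inserted separately.\<close>
  have "i \<in> (+) n ` cuts I \<longleftrightarrow> n < i \<and> separated I (i - n)" if "\<not> separated I 0" for i n
    using that by (auto simp: cuts_def image_iff intro!: exI[of _ "i - n"])
      (metis gr0I)
  moreover have "\<not> separated I 0"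
    by (auto simp: separated_def sentence_size_def)
  ultimately show ?thesis
    by (auto simp: cuts_def separated_Cons)
qed

lemma cuts_subset: "cuts I \<subseteq> {0<..<sentence_size I}"
  by (auto simp: cuts_def separated_def sentence_size_def)

lemma finite_cuts: "finite (cuts I)"
  by (rule finite_subset[OF cuts_subset]) simp

lemma card_cuts: "I \<noteq> [] \<Longrightarrow> length I = Suc (card (cuts I))"
proof (induction I)
  case (Cons w I)
  show ?case
  proof (cases "I = []")
    case False
    have "length (letters w) \<notin> (+) (length (letters w)) ` cuts I"
      using cuts_subset[of I] by auto
    then show ?thesis using Cons False
      by (simp add: cuts_Cons finite_cuts card_image)
  qed (simp add: cuts_Cons)
qed simp

lemma cuts_inject:
  assumes "maximal_word J = maximal_word K" "cuts J = cuts K" shows "J = K"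
  using assms by (intro sentence_eqI) (auto simp: cuts_def)

text \<open>Together with \<open>cuts_inject\<close> this identifies the sentences with maximal word
  \<open>w\<close> with the subsets of \<open>{0<..<length w}\<close>.\<close>

lemma ex_cuts:
  assumes "T \<subseteq> {0<..<length w}"
  obtains J where "maximal_word J = w" "cuts J = T"
proof -
  obtain J where J: "maximal_word J = w"
    "\<forall>i. 0 < i \<and> i < length w \<longrightarrow> (separated J i \<longleftrightarrow> i \<in> T)"
    using ex_sentence[of w "\<lambda>i. i \<in> T"] by blast
  moreover have "cuts J = T"
    using J cuts_subset[of J] assms by (auto simp: cuts_def sentence_size_def)
  ultimately show ?thesis using that by blast
qed

text \<open>A cut of \<open>I\<close> splits the grouping of \<open>J\<close> in two, hence is a cut
  of \<open>J\<close>. Conversely, the end of the first word of \<open>I\<close> is a cut of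
  \<open>J\<close>; splitting \<open>J\<close> there yields the first group, and the rest is handled
  by induction.\<close>

lemma refines_iff_cuts:
  "refines J I \<longleftrightarrow> maximal_word J = maximal_word I \<and> cuts I \<subseteq> cuts J"
proof
  assume J: "refines J I"
  then obtain G where G: "concat G = J" "map maximal_word G = map letters I"
    by (auto simp: refines_def)
  have "separated J i" if i: "separated I i" for i
  proof -
    obtain I1 I2 where I: "I = I1 @ I2" "I1 \<noteq> []" "I2 \<noteq> []" "sentence_size I1 = i"
      using i unfolding separated_def by blast
    obtain G1 G2 where G12: "G = G1 @ G2" "map maximal_word G1 = map letters I1"
      "map maximal_word G2 = map letters I2"
      using G(2) I(1) by (auto simp: map_eq_append_conv)
    have m: "maximal_word (concat G1) = maximal_word I1" "maximal_word (concat G2) = maximal_word I2"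
      using G12 by (simp_all add: maximal_word_concat maximal_word_def[of I1] maximal_word_def[of I2])
    then have "concat G1 \<noteq> []" "concat G2 \<noteq> []"
      using I(2,3) by (metis maximal_word_eq_Nil)+
    moreover have "sentence_size (concat G1) = i" using m I(4) by (simp add: sentence_size_def)
    moreover have "J = concat G1 @ concat G2" using G G12 by simp
    ultimately show ?thesis unfolding separated_def by blast
  qed
  then show "maximal_word J = maximal_word I \<and> cuts I \<subseteq> cuts J"
    using refines_maximal_word[OF J] by (auto simp: cuts_def)
next
  show "maximal_word J = maximal_word I \<and> cuts I \<subseteq> cuts J \<Longrightarrow> refines J I"
  proof (induction I arbitrary: J)
    case Nil
    then show ?case by simp
  next
    case (Cons w I)
    show ?case
    proof (cases "I = []")
      case True
      then show ?thesis using Cons.prems unfolding refines_def by (intro exI[of _ "[J]"]) simp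
    next
      case False
      then have "length (letters w) \<in> cuts J" using Cons.prems by (auto simp: cuts_Cons)
      then obtain J1 J2 where J: "J = J1 @ J2" "sentence_size J1 = length (letters w)"
        by (auto simp: cuts_def separated_def)
      then have m: "maximal_word J1 = letters w" "maximal_word J2 = maximal_word I"
        using Cons.prems by (auto simp: sentence_size_def)
      \<comment> \<open>Shifted by the length of \<open>w\<close>, a cut of \<open>I\<close> is a
        cut of \<open>J\<close>; being positive before the shift, it lies strictly to the right of
        \<open>J1\<close>, hence inside \<open>J2\<close>.\<close>
      have "i \<in> cuts J2" if "i \<in> cuts I" for i
      proof -
        have "length (letters w) + i \<in> cuts J" "0 < i"
          using that False Cons.prems cuts_subset[of I] by (auto simp: cuts_Cons)
        then obtain K1 K2 where K: "J1 @ J2 = K1 @ K2" "K2 \<noteq> []"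
          "sentence_size K1 = sentence_size J1 + i"
          using J by (auto simp: cuts_def separated_def)
        then consider L where "K1 = J1 @ L" "J2 = L @ K2" | L where "J1 = K1 @ L"
          by (auto simp: append_eq_append_conv2)
        then show ?thesis
        proof cases
          case 1
          then have "J2 = L @ K2 \<and> L \<noteq> [] \<and> K2 \<noteq> [] \<and> sentence_size L = i"
            using K \<open>0 < i\<close> by (auto simp: sentence_size_def)
          then show ?thesis unfolding cuts_def separated_def by blast
        next
          case 2
          then show ?thesis using K(3) \<open>0 < i\<close> by (simp add: sentence_size_def)
        qed
      qed
      then have "refines J2 I" using Cons.IH m by blast
      then obtain G where "concat G = J2" "map maximal_word G = map letters I"
        by (auto simp: refines_def)
      then show ?thesis unfolding refines_def using J m by (intro exI[of _ "J1 # G"]) simp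
    qed
  qed
qed

lemma is_complement_complement: "is_complement I (complement I)"
  unfolding complement_def by (rule theI'[OF ex1_complement])

lemma maximal_word_complement: "maximal_word (complement I) = maximal_word I"
  using is_complement_complement[of I] by (simp add: is_complement_def)

lemma cuts_complement: "cuts (complement I) = {0<..<sentence_size I} - cuts I"
  using is_complement_complement[of I] cuts_subset[of "complement I"]
  by (auto simp: is_complement_def cuts_def sentence_size_def)

section \<open>Alternating sums over common refinements\<close>

text \<open>An interval of the subset lattice with more than one element has as many members of even
  as of odd cardinality.\<close>

lemma sum_supersets_alternating:
  assumes "finite S" "T \<subseteq> S"
  shows "(\<Sum>U | T \<subseteq> U \<and> U \<subseteq> S. (- 1) ^ card U) =
    (if T = S then (- 1) ^ card S else 0 :: 'k::ring_1)"
proof (cases "T = S")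
  case True
  then have "{U. T \<subseteq> U \<and> U \<subseteq> S} = {S}" by auto
  then show ?thesis using True by simp
next
  case False
  have "card {U. U \<subseteq> S \<and> T \<subseteq> U \<and> even (card U)} = card {U. U \<subseteq> S \<and> T \<subseteq> U \<and> odd (card U)}"
    by (rule card_subsupersets_even_odd) (use assms False in auto)
  then have "(\<Sum>U | T \<subseteq> U \<and> U \<subseteq> S. (- 1) ^ card U) = (0 :: 'k)"
    using assms(1) by (intro sum_alternating_cancels) (simp_all add: conj_ac)
  then show ?thesis using False by simp
qed

lemma sum_common_refinements:
  assumes "maximal_word K = maximal_word I"
  shows "(\<Sum>J | refines J I \<and> refines J K. (-1) ^ length J) =
    (if refines K (complement I) then (-1) ^ sentence_size I else 0 :: 'k::ring_1)"
\<comment> \<open>The empty sentence is separate: its number of words is not one more than its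
  number of cuts.\<close>
proof (cases "I = []")
  case True
  then have "K = []" "complement I = []"
    using assms maximal_word_complement[of I] by simp_all
  moreover have "{J. refines J ([] :: 'a sentence) \<and> refines J []} = {[]}"
    by (auto simp: refines_Nil_right)
  ultimately show ?thesis using True by (simp add: sentence_size_def)
next
  case False
  let ?w = "maximal_word I" and ?S = "{0<..<sentence_size I}" and ?T = "cuts I \<union> cuts K"
  let ?R = "{J. refines J I \<and> refines J K}"
  have size: "sentence_size K = sentence_size I" using assms by (simp add: sentence_size_def)
  have T: "?T \<subseteq> ?S" using cuts_subset[of I] cuts_subset[of K] size by auto
  have R: "J \<in> ?R \<longleftrightarrow> maximal_word J = ?w \<and> ?T \<subseteq> cuts J" for J
    using assms by (auto simp: refines_iff_cuts)
  have "bij_betw cuts ?R {U. ?T \<subseteq> U \<and> U \<subseteq> ?S}"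
  proof (rule bij_betw_imageI)
    show "inj_on cuts ?R" by (rule inj_onI, rule cuts_inject) (simp_all only: R)
    show "cuts ` ?R = {U. ?T \<subseteq> U \<and> U \<subseteq> ?S}"
    proof (intro equalityI subsetI)
      fix U assume "U \<in> cuts ` ?R"
      then obtain J where "U = cuts J" "maximal_word J = ?w" "?T \<subseteq> cuts J" using R by auto
      then show "U \<in> {U. ?T \<subseteq> U \<and> U \<subseteq> ?S}"
        using cuts_subset[of J] by (simp add: sentence_size_def)
    next
      fix U assume U: "U \<in> {U. ?T \<subseteq> U \<and> U \<subseteq> ?S}"
      then obtain J where J: "maximal_word J = ?w" "cuts J = U"
        using ex_cuts[of U ?w] by (auto simp: sentence_size_def)
      then have "J \<in> ?R" using U R by simp
      then show "U \<in> cuts ` ?R" using J by blast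
    qed
  qed
  \<comment> \<open>The minus sign accounts for a sentence having one more word than cuts. It is
    absorbed at the end, as \<open>?S\<close> has one element less than
    \<open>sentence_size I\<close>.\<close>
  then have "(\<Sum>U | ?T \<subseteq> U \<and> U \<subseteq> ?S. - ((-1) ^ card U)) =
      (\<Sum>J\<in>?R. - ((-1) ^ card (cuts J)) :: 'k)"
    by (rule sum.reindex_bij_betw[symmetric])
  also have "\<dots> = (\<Sum>J\<in>?R. (-1) ^ length J)"
  proof (rule sum.cong[OF refl])
    fix J assume "J \<in> ?R"
    then have "J \<noteq> []" using False by auto
    then show "- ((-1) ^ card (cuts J)) = ((-1) ^ length J :: 'k)" by (simp add: card_cuts)
  qed
  finally have "(\<Sum>J\<in>?R. (-1) ^ length J) = (if ?T = ?S then - ((-1) ^ card ?S) else 0 :: 'k)"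
    by (simp only: sum_negf sum_supersets_alternating[OF _ T] finite_greaterThanLessThan)
       (simp split: if_splits)
  moreover have "?T = ?S \<longleftrightarrow> refines K (complement I)"
    using T assms by (auto simp: refines_iff_cuts maximal_word_complement cuts_complement)
  moreover have "sentence_size I = Suc (card ?S)"
    using False by (cases "sentence_size I") (auto simp: sentence_size_def)
  then have "- ((-1) ^ card ?S) = ((-1) ^ sentence_size I :: 'k)" by (metis power_Suc mult_minus1)
  ultimately show ?thesis by simp
qed

section \<open>The antipode on the fundamental basis\<close>

theorem proposition5p3:
  fixes I :: "'a::finite sentence"
  shows "(antipode (F I) :: ('a, 'k::field_char_0) qsym) =
    scale ((-1) ^ sentence_size I) (qrev (F (complement I)))"
proof -
  let ?W = "{K. maximal_word K = maximal_word I}"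
  let ?m = "\<lambda>K. M (rev K) :: ('a, 'k) qsym"
  have fin: "finite ?W" by (rule finite_maximal_word)
  have lin_rev: "lin (qrev :: ('a, 'k) qsym \<Rightarrow> _)" unfolding qrev_def by (rule lin_lin_extend)
  have "(antipode (F I) :: ('a, 'k) qsym) =
      (\<Sum>J | refines J I. \<Sum>K | refines J K. scale ((-1) ^ length J) (?m K))"
    by (simp add: antipode_eq F_def pmp.linear_sum[OF lin_qsym_antipode] qsym_antipode_M
        pm.scale_sum_right)
  \<comment> \<open>Letting \<open>K\<close> range over all sentences with this maximal word makes
    its index set independent of \<open>J\<close>, so that the sums can be exchanged.\<close>
  also have "\<dots> = (\<Sum>J | refines J I. \<Sum>K\<in>?W. if refines J K then scale ((-1) ^ length J) (?m K) else 0)"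
    by (intro sum.cong refl sum.mono_neutral_cong_left fin)
      (auto dest!: refines_maximal_word)
  also have "\<dots> = (\<Sum>K\<in>?W. \<Sum>J | refines J I. if refines J K then scale ((-1) ^ length J) (?m K) else 0)"
    by (rule sum.swap)
  \<comment> \<open>The coefficient of \<open>M (rev K)\<close> is now the alternating sum over the
    common refinements of \<open>I\<close> and \<open>K\<close>.\<close>
  also have "\<dots> = (\<Sum>K\<in>?W. scale (\<Sum>J | refines J I \<and> refines J K. (-1) ^ length J) (?m K))"
    by (intro sum.cong refl, simp add: pm.scale_sum_left,
        intro sum.mono_neutral_cong_right finite_refines) auto
  also have "\<dots> = (\<Sum>K\<in>?W. if refines K (complement I)
      then scale ((-1) ^ sentence_size I) (?m K) else 0)"
    by (intro sum.cong refl) (simp add: sum_common_refinements)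
  also have "\<dots> = (\<Sum>K | refines K (complement I). scale ((-1) ^ sentence_size I) (?m K))"
    by (intro sum.mono_neutral_cong_right fin)
      (auto dest: refines_maximal_word simp: maximal_word_complement)
  also have "\<dots> = scale ((-1) ^ sentence_size I) (qrev (F (complement I)))"
    by (simp add: F_def pmp.linear_sum[OF lin_rev] pm.scale_sum_right) (simp add: qrev_def)
  finally show ?thesis .
qed

end
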